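(* Let $A$ be a nonempty finite set of positive integers, $a_1=\min(A)$, and let $n,d,e\in\mathbb{N}$. Let $g_A^{I},g_A^{II}$ be the functions defined in the context. 1. If $d\ge g_A^{I}(n)$ and $e<g_A^{II}(n)$, then $W_A^{\rm cash}(n;d,e)=\mathrm{I}$. 2. If $d<g_A^{I}(n)$ and $e\ge g_A^{II}(n)$, then $W_A^{\rm cash}(n;d,e)=\mathrm{II}$. 3. If $d<g_A^{I}(n)$ and $e<g_A^{II}(n)$, then $W_A^{\rm cash}(n;d,e)=\mathrm{I}$ if and only if $\left\lfloor\frac{d}{a_1}\right\rfloor>\left\lfloor\frac{e}{a_1}\right\rfloor$.
   Context: $\mathbb{N}=\{0,1,2,\dots\}$. NIM with cash for $A$, state $(n;d,e)$: $n$ stones are on the board, Player I (who moves first) has $d$ dollars and Player II has $e$ dollars. Players alternate. A player removing $a\in A$ stones also loses $a$ dollars, so $a$ may exceed neither the number of stones nor the mover's dollars. A player who cannot move (fewer than $a_1$ stones, or he has fewer than $a_1$ dollars) loses. $W_A^{\rm cash}(n;d,e)\in\{\mathrm{I},\mathrm{II}\}$ is the player with a winning strategy. Equivalently, $W_A^{\rm cash}(n;d,e)=\mathrm{I}$ iff there is $a\in A$ with $a\le n$, $a\le d$ and $W_A^{\rm cash}(n-a;e,d-a)=\mathrm{II}$. For an integer $n$ let $i\in\{0,\dots,2a_1-1\}$ be the residue of $n$ modulo $2a_1$, and set $$g_A^{I}(n)=\frac{n-i}{2}+\min\{i+1,a_1\},\qquad g_A^{II}(n)=\frac{n-i}{2}+\max\{0,i-a_1+1\}.$$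 *)

theory Defs
  imports Main
begin

datatype player = PlayerI | PlayerII

fun opponent :: "player \<Rightarrow> player" where
  "opponent PlayerI = PlayerII"
| "opponent PlayerII = PlayerI"

(* A position consists of the number of stones on the board, the dollars of each player
   and the player to move. *)
type_synonym position = "nat \<times> (player \<Rightarrow> nat) \<times> player"

fun to_move :: "position \<Rightarrow> player" where
  "to_move (n, c, p) = p"

fun legal :: "nat set \<Rightarrow> position \<Rightarrow> nat \<Rightarrow> bool" where
  "legal A (n, c, p) a \<longleftrightarrow> a \<in> A \<and> a \<le> n \<and> a \<le> c p"

fun move :: "position \<Rightarrow> nat \<Rightarrow> position" where
  "move (n, c, p) a = (n - a, c(p := c p - a), opponent p)"

fun is_play :: "nat set \<Rightarrow> position \<Rightarrow> nat list \<Rightarrow> bool" where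
  "is_play A s [] \<longleftrightarrow> True"
| "is_play A s (a # ms) \<longleftrightarrow> legal A s a \<and> is_play A (move s a) ms"

definition position_after :: "position \<Rightarrow> nat list \<Rightarrow> position" where
  "position_after s ms = foldl move s ms"

definition stuck :: "nat set \<Rightarrow> position \<Rightarrow> bool" where
  "stuck A s \<longleftrightarrow> (\<nexists>a. legal A s a)"

(* A strategy prescribes a move depending on the whole list of previous moves of both players.
   It must be legal whenever its owner can move at all, even after histories that the strategy
   itself would avoid. *)
definition is_strategy :: "nat set \<Rightarrow> position \<Rightarrow> player \<Rightarrow> (nat list \<Rightarrow> nat) \<Rightarrow> bool" where
  "is_strategy A s p \<sigma> \<longleftrightarrow>
     (\<forall>ms. is_play A s ms \<and> to_move (position_after s ms) = p \<and> \<not> stuck A (position_after s ms)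
        \<longrightarrow> legal A (position_after s ms) (\<sigma> ms))"

definition follows :: "position \<Rightarrow> player \<Rightarrow> (nat list \<Rightarrow> nat) \<Rightarrow> nat list \<Rightarrow> bool" where
  "follows s p \<sigma> ms \<longleftrightarrow>
     (\<forall>k < length ms. to_move (position_after s (take k ms)) = p \<longrightarrow> ms ! k = \<sigma> (take k ms))"

(* Only finite plays are considered: if 0 is not in A, every play is finite, because each move
   removes at least one stone. *)
definition winning_strategy :: "nat set \<Rightarrow> position \<Rightarrow> player \<Rightarrow> (nat list \<Rightarrow> nat) \<Rightarrow> bool" where
  "winning_strategy A s p \<sigma> \<longleftrightarrow> is_strategy A s p \<sigma> \<and>
     (\<forall>ms. is_play A s ms \<and> follows s p \<sigma> ms \<and> stuck A (position_after s ms)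
        \<longrightarrow> to_move (position_after s ms) = opponent p)"

definition start :: "nat \<Rightarrow> nat \<Rightarrow> nat \<Rightarrow> position" where
  "start n d e = (n, (\<lambda>p. case p of PlayerI \<Rightarrow> d | PlayerII \<Rightarrow> e), PlayerI)"

definition W_cash :: "nat set \<Rightarrow> nat \<Rightarrow> nat \<Rightarrow> nat \<Rightarrow> player" where
  "W_cash A n d e = (THE p. \<exists>\<sigma>. winning_strategy A (start n d e) p \<sigma>)"

(* The division by 2 in g_I and g_II is exact. *)
definition g_I :: "nat set \<Rightarrow> int \<Rightarrow> int" where
  "g_I A n = (let a = int (Min A); i = n mod (2 * a) in (n - i) div 2 + min (i + 1) a)"

definition g_II :: "nat set \<Rightarrow> int \<Rightarrow> int" where
  "g_II A n = (let a = int (Min A); i = n mod (2 * a) in (n - i) div 2 + max 0 (i - a + 1))"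


lemma position_after_simps [simp]:
  "position_after s [] = s"
  "position_after s (a # ms) = position_after (move s a) ms"
  by (simp_all add: position_after_def)

lemma follows_Nil: "follows s p \<sigma> []"
  by (simp add: follows_def)

lemma follows_Cons:
  "follows s p \<sigma> (a # ms) \<longleftrightarrow>
     (to_move s = p \<longrightarrow> a = \<sigma> []) \<and> follows (move s a) p (\<lambda>ms. \<sigma> (a # ms)) ms"
  by (auto simp: follows_def nth_Cons take_Cons all_conj_distrib less_Suc_eq_0_disj
      split: nat.splits)

lemma opponent_neq [simp]: "opponent p \<noteq> p" "p \<noteq> opponent p"
  by (cases p; simp)+

lemma opponent_opponent [simp]: "opponent (opponent p) = p"
  by (cases p) simp_all

lemma opponent_iff: "q = opponent p \<longleftrightarrow> q \<noteq> p"
  by (cases p; cases q) simp_all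

definition wins :: "nat set \<Rightarrow> position \<Rightarrow> player \<Rightarrow> bool" where
  "wins A s p \<longleftrightarrow> (\<exists>\<sigma>. winning_strategy A s p \<sigma>)"

lemma is_strategy_Cons:
  "is_strategy A s p \<sigma> \<longleftrightarrow> (to_move s = p \<and> \<not> stuck A s \<longrightarrow> legal A s (\<sigma> [])) \<and>
     (\<forall>a. legal A s a \<longrightarrow> is_strategy A (move s a) p (\<lambda>ms. \<sigma> (a # ms)))"
proof
  assume L: "is_strategy A s p \<sigma>"
  show "(to_move s = p \<and> \<not> stuck A s \<longrightarrow> legal A s (\<sigma> [])) \<and>
     (\<forall>a. legal A s a \<longrightarrow> is_strategy A (move s a) p (\<lambda>ms. \<sigma> (a # ms)))"
    using L[unfolded is_strategy_def, rule_format, of "[]"]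
      L[unfolded is_strategy_def, rule_format, of "_ # _"]
    by (simp add: is_strategy_def)
next
  assume R: "(to_move s = p \<and> \<not> stuck A s \<longrightarrow> legal A s (\<sigma> [])) \<and>
     (\<forall>a. legal A s a \<longrightarrow> is_strategy A (move s a) p (\<lambda>ms. \<sigma> (a # ms)))"
  show "is_strategy A s p \<sigma>"
    unfolding is_strategy_def
  proof (intro allI impI)
    show "legal A (position_after s ms) (\<sigma> ms)"
      if "is_play A s ms \<and> to_move (position_after s ms) = p \<and> \<not> stuck A (position_after s ms)"
      for ms
      using that R by (cases ms) (auto simp: is_strategy_def)
  qed
qed

lemma winning_strategy_Cons:
  "winning_strategy A s p \<sigma> \<longleftrightarrow> is_strategy A s p \<sigma> \<and> (stuck A s \<longrightarrow> to_move s = opponent p) \<and>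
     (\<forall>a. legal A s a \<and> (to_move s = p \<longrightarrow> a = \<sigma> []) \<longrightarrow>
        winning_strategy A (move s a) p (\<lambda>ms. \<sigma> (a # ms)))" (is "?L \<longleftrightarrow> ?R")
proof
  assume L: ?L
  show ?R
  proof (intro conjI allI impI)
    show "is_strategy A s p \<sigma>" using L by (simp add: winning_strategy_def)
    show "to_move s = opponent p" if "stuck A s"
      using L that follows_Nil unfolding winning_strategy_def
      by (metis is_play.simps(1) position_after_simps(1))
    show "winning_strategy A (move s a) p (\<lambda>ms. \<sigma> (a # ms))"
      if a: "legal A s a \<and> (to_move s = p \<longrightarrow> a = \<sigma> [])" for a
      unfolding winning_strategy_def
    proof (intro conjI allI impI)
      show "is_strategy A (move s a) p (\<lambda>ms. \<sigma> (a # ms))"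
        using L a is_strategy_Cons unfolding winning_strategy_def by blast
      show "to_move (position_after (move s a) ms) = opponent p"
        if "is_play A (move s a) ms \<and> follows (move s a) p (\<lambda>ms. \<sigma> (a # ms)) ms \<and>
            stuck A (position_after (move s a) ms)" for ms
        using L a that follows_Cons[of s p \<sigma> a ms] unfolding winning_strategy_def
        by (metis is_play.simps(2) position_after_simps(2))
    qed
  qed
next
  assume R: ?R
  show ?L
    unfolding winning_strategy_def
  proof (intro conjI allI impI)
    show "is_strategy A s p \<sigma>" using R by simp
    show "to_move (position_after s ms) = opponent p"
      if "is_play A s ms \<and> follows s p \<sigma> ms \<and> stuck A (position_after s ms)" for ms
      using that R by (cases ms) (auto simp: follows_Cons winning_strategy_def)
  qed
qed

lemma is_strategy_exists: "\<exists>\<sigma>. is_strategy A s p \<sigma>"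
  by (rule exI[of _ "\<lambda>ms. SOME a. legal A (position_after s ms) a"])
     (auto simp: is_strategy_def stuck_def intro: someI)

lemma wins_rec_mover:
  assumes "to_move s = p"
  shows "wins A s p \<longleftrightarrow> (\<exists>a. legal A s a \<and> wins A (move s a) p)"
proof
  assume "wins A s p"
  then show "\<exists>a. legal A s a \<and> wins A (move s a) p"
    using assms is_strategy_Cons[of A s p] winning_strategy_Cons[of A s p]
    unfolding wins_def by (metis opponent_neq(2))
next
  assume "\<exists>a. legal A s a \<and> wins A (move s a) p"
  then obtain a \<sigma> where a: "legal A s a" and \<sigma>: "winning_strategy A (move s a) p \<sigma>"
    unfolding wins_def by blast
  obtain \<tau> where \<tau>: "\<And>b. is_strategy A (move s b) p (\<tau> b)"
    using choice[of "\<lambda>b. is_strategy A (move s b) p"] is_strategy_exists by blast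
  define \<rho> where "\<rho> = (\<lambda>ms. case ms of [] \<Rightarrow> a | b # ms' \<Rightarrow> if b = a then \<sigma> ms' else \<tau> b ms')"
  have "(\<lambda>ms. \<rho> (b # ms)) = (if b = a then \<sigma> else \<tau> b)" for b
    by (auto simp: \<rho>_def)
  moreover have "\<rho> [] = a" by (simp add: \<rho>_def)
  ultimately have "winning_strategy A s p \<rho>"
    using assms a \<sigma> \<tau> by (subst winning_strategy_Cons, subst is_strategy_Cons)
      (auto simp: stuck_def winning_strategy_def)
  then show "wins A s p" unfolding wins_def by blast
qed

lemma wins_rec_other:
  assumes "to_move s \<noteq> p"
  shows "wins A s p \<longleftrightarrow> (\<forall>a. legal A s a \<longrightarrow> wins A (move s a) p)"
proof
  assume "wins A s p"
  then show "\<forall>a. legal A s a \<longrightarrow> wins A (move s a) p"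
    using assms winning_strategy_Cons[of A s p] unfolding wins_def by metis
next
  assume "\<forall>a. legal A s a \<longrightarrow> wins A (move s a) p"
  then obtain \<tau> where \<tau>: "\<And>a. legal A s a \<Longrightarrow> winning_strategy A (move s a) p (\<tau> a)"
    unfolding wins_def by metis
  define \<rho> where "\<rho> = (\<lambda>ms. case ms of [] \<Rightarrow> 0 | b # ms' \<Rightarrow> \<tau> b ms')"
  have "(\<lambda>ms. \<rho> (b # ms)) = \<tau> b" for b
    by (auto simp: \<rho>_def)
  then have "winning_strategy A s p \<rho>"
    using assms \<tau> by (subst winning_strategy_Cons, subst is_strategy_Cons)
      (auto simp: winning_strategy_def opponent_iff)
  then show "wins A s p" unfolding wins_def by blast
qed

lemma to_move_move [simp]: "to_move (move s a) = opponent (to_move s)"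
  by (cases s) simp

lemma stones_move: "0 \<notin> A \<Longrightarrow> legal A s a \<Longrightarrow> fst (move s a) < fst s"
  by (cases s; cases "a = 0") auto

lemma determined:
  assumes "0 \<notin> A"
  shows "wins A s (opponent p) \<longleftrightarrow> \<not> wins A s p"
proof (induction "fst s" arbitrary: s p rule: less_induct)
  case less
  then have IH: "wins A (move s a) (opponent p) \<longleftrightarrow> \<not> wins A (move s a) p" if "legal A s a" for a
    using less.hyps[OF stones_move[OF assms that]] by blast
  show ?case
  proof (cases "to_move s = p")
    case True
    then have "to_move s \<noteq> opponent p" by simp
    from wins_rec_mover[OF True] wins_rec_other[OF this] show ?thesis using IH by blast
  next
    case False
    then have "to_move s = opponent p" by (simp add: opponent_iff)
    from wins_rec_mover[OF this] wins_rec_other[OF False] show ?thesis using IH by blast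
  qed
qed

lemma W_cash_eq_iff:
  assumes "0 \<notin> A"
  shows "W_cash A n d e = p \<longleftrightarrow> wins A (start n d e) p"
proof -
  have "wins A (start n d e) PlayerII \<longleftrightarrow> \<not> wins A (start n d e) PlayerI"
    using determined[OF assms, of _ PlayerI] by simp
  then have ex1: "\<exists>!q. wins A (start n d e) q"
    by (metis (full_types) player.exhaust)
  then show ?thesis
    unfolding W_cash_def wins_def[symmetric]
    using theI'[OF ex1] the1_equality[OF ex1] by blast
qed

definition swap :: "position \<Rightarrow> position" where
  "swap s = (case s of (n, c, p) \<Rightarrow> (n, c \<circ> opponent, opponent p))"

lemma swap_simps:
  "legal A (swap s) a \<longleftrightarrow> legal A s a"
  "move (swap s) a = swap (move s a)"
  "to_move (swap s) = opponent (to_move s)"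
proof -
  obtain n c p where s: "s = (n, c, p)" by (cases s)
  have "((c \<circ> opponent)(opponent p := c p - a)) q = ((c(p := c p - a)) \<circ> opponent) q" for q
    by (cases p; cases q) simp_all
  then show "move (swap s) a = swap (move s a)"
    by (simp add: s swap_def fun_eq_iff)
qed (cases s; simp add: swap_def)+

lemma wins_swap:
  assumes "0 \<notin> A"
  shows "wins A (swap s) (opponent p) \<longleftrightarrow> wins A s p"
proof (induction "fst s" arbitrary: s rule: less_induct)
  case less
  then have IH: "wins A (swap (move s a)) (opponent p) \<longleftrightarrow> wins A (move s a) p"
    if "legal A s a" for a
    using less.hyps[OF stones_move[OF assms that]] by blast
  show ?case
  proof (cases "to_move s = p")
    case True
    then have "to_move (swap s) = opponent p" by (simp add: swap_simps)
    from wins_rec_mover[OF True] wins_rec_mover[OF this] show ?thesis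
      using IH unfolding swap_simps by blast
  next
    case False
    then have "to_move (swap s) \<noteq> opponent p" by (metis opponent_opponent swap_simps(3))
    from wins_rec_other[OF False] wins_rec_other[OF this] show ?thesis
      using IH unfolding swap_simps by blast
  qed
qed

lemma W_cash_rec:
  assumes "0 \<notin> A"
  shows "W_cash A n d e = PlayerI \<longleftrightarrow>
    (\<exists>a\<in>A. a \<le> n \<and> a \<le> d \<and> W_cash A (n - a) e (d - a) = PlayerII)"
proof -
  have sw: "move (start n d e) a = swap (start (n - a) e (d - a))" for a
    by (auto simp: start_def swap_def fun_eq_iff split: player.splits)
  have m: "to_move (start n d e) = PlayerI" by (simp add: start_def)
  have l: "legal A (start n d e) a \<longleftrightarrow> a \<in> A \<and> a \<le> n \<and> a \<le> d" for a
    by (simp add: start_def)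
  have w: "wins A (swap (start (n - a) e (d - a))) PlayerI \<longleftrightarrow>
      wins A (start (n - a) e (d - a)) PlayerII" for a
    using wins_swap[OF assms, of _ PlayerII] by simp
  show ?thesis
    using wins_rec_mover[OF m, of A] unfolding W_cash_eq_iff[OF assms] sw l w by blast
qed

end

theory Submission
  imports Defs
begin

text \<open>
  Write \<open>m\<close> for the least element of \<open>A\<close>. The two thresholds are one function seen from the two
  seats: \<open>g\<^sup>I\<^sup>I(n) = g\<^sup>I(n - m)\<close> and \<open>g\<^sup>I(n) + g\<^sup>I\<^sup>I(n) = n + 1\<close>. As \<open>g\<^sup>I\<close> is
  monotone, they give \<open>g\<^sup>I(n - a) \<le> g\<^sup>I\<^sup>I(n)\<close> and \<open>g\<^sup>I(n) - a \<le> g\<^sup>I\<^sup>I(n - a)\<close> for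
  every move \<open>a \<ge> m\<close>, with equality for \<open>a = m\<close>. After a move the players swap seats, and these
  relations say how their wealth compares with the thresholds there: a mover below his threshold
  stays below the new one whatever he removes, an opponent at or above his threshold stays so too,
  and removing \<open>m\<close> stones keeps a mover at or above his threshold and an opponent below his.
  Call a player rich if he reaches his threshold and poor otherwise. A rich player thus beats a
  poor one, by taking \<open>m\<close> at each of his turns.

  If both are poor, money rather than stones is what runs out. A player with \<open>d\<close> dollars can move
  at most \<open>\<lfloor>d/m\<rfloor>\<close> times, and taking \<open>m\<close> each time attains this bound while leaving
  the opponent poor, whereas a larger removal costs more and may even leave the opponent rich. So
  the comparison of these quotients decides the game. All three claims are
  proved together, by strong induction on the number of stones.
\<close>

lemma g_I_div_mod:
  fixes n :: int
  assumes "0 < Min A"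
  defines "m \<equiv> int (Min A)"
  shows "g_I A n = m * (n div (2 * m)) + min (n mod (2 * m) + 1) m"
    and "g_II A n = m * (n div (2 * m)) + max 0 (n mod (2 * m) - m + 1)"
proof -
  have "n - n mod (2 * m) = 2 * (m * (n div (2 * m)))"
    using minus_mod_eq_mult_div[of n "2 * m"] by simp
  then have "(n - n mod (2 * m)) div 2 = m * (n div (2 * m))"
    by simp
  then show "g_I A n = m * (n div (2 * m)) + min (n mod (2 * m) + 1) m"
    and "g_II A n = m * (n div (2 * m)) + max 0 (n mod (2 * m) - m + 1)"
    by (simp_all add: g_I_def g_II_def m_def Let_def)
qed

lemma g_I_plus_g_II:
  assumes "0 < Min A"
  shows "g_I A n + g_II A n = n + 1"
proof -
  define m where "m = int (Min A)"
  have "n = 2 * (m * (n div (2 * m))) + n mod (2 * m)"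
    by (metis mult.assoc mult_div_mod_eq)
  moreover have "g_I A n = m * (n div (2 * m)) + min (n mod (2 * m) + 1) m"
    and "g_II A n = m * (n div (2 * m)) + max 0 (n mod (2 * m) - m + 1)"
    using g_I_div_mod[OF assms] by (simp_all add: m_def)
  ultimately show ?thesis
    by linarith
qed

text \<open>
  The second player's threshold is the one he faces as the mover once \<open>Min A\<close> stones are gone.
  The shift by half a period swaps the rising and the flat half of the period.
\<close>

lemma g_II_eq_g_I_shift:
  assumes "0 < Min A"
  shows "g_II A n = g_I A (n - int (Min A))"
proof -
  define m where "m = int (Min A)"
  define q where "q = n div (2 * m)"
  define i where "i = n mod (2 * m)"
  have m: "0 < m" using assms by (simp add: m_def)
  have i: "0 \<le> i" "i < 2 * m" using m by (simp_all add: i_def)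
  have n: "n = 2 * m * q + i" by (simp add: q_def i_def)
  note gI = g_I_div_mod(1)[OF assms, folded m_def]
  have gII: "g_II A n = m * q + max 0 (i - m + 1)"
    using g_I_div_mod(2)[OF assms] by (simp add: m_def q_def i_def)
  show ?thesis
  proof (cases "i < m")
    case True
    have "(n - m) div (2 * m) = q - 1"
      using True i by (intro int_div_pos_eq[where r = "i + m"]) (auto simp: n algebra_simps)
    moreover have "(n - m) mod (2 * m) = i + m"
      using True i by (intro int_mod_pos_eq[where q = "q - 1"]) (auto simp: n algebra_simps)
    ultimately show ?thesis
      using True i unfolding m_def[symmetric] gII gI
      by (simp add: right_diff_distrib)
  next
    case False
    have "(n - m) div (2 * m) = q"
      using False i by (intro int_div_pos_eq[where r = "i - m"]) (auto simp: n algebra_simps)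
    moreover have "(n - m) mod (2 * m) = i - m"
      using False i by (intro int_mod_pos_eq[where q = q]) (auto simp: n algebra_simps)
    ultimately show ?thesis
      using False i unfolding m_def[symmetric] gII gI
      by (simp add: algebra_simps)
  qed
qed

lemma mono_g_I:
  assumes "0 < Min A"
  shows "mono (g_I A)"
proof (rule monoI)
  fix k n :: int
  assume "k \<le> n"
  define m where "m = int (Min A)"
  have m: "0 < m" using assms by (simp add: m_def)
  note g = g_I_div_mod[OF assms, folded m_def]
  have le: "k div (2 * m) \<le> n div (2 * m)"
    using \<open>k \<le> n\<close> m by (simp add: zdiv_mono1)
  show "g_I A k \<le> g_I A n"
  proof (cases "k div (2 * m) = n div (2 * m)")
    case True
    have "k mod (2 * m) \<le> n mod (2 * m)"
      using \<open>k \<le> n\<close> mult_div_mod_eq[of "2 * m" k] mult_div_mod_eq[of "2 * m" n]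
      unfolding True by linarith
    then show ?thesis
      by (simp add: g True)
  next
    case False
    then have "k div (2 * m) + 1 \<le> n div (2 * m)" using le by simp
    then have "m * (k div (2 * m) + 1) \<le> m * (n div (2 * m))"
      using m by simp
    then have "m * (k div (2 * m)) + m \<le> m * (n div (2 * m))"
      by (simp add: distrib_left)
    moreover have "0 \<le> n mod (2 * m)" using m by simp
    ultimately show ?thesis
      using m unfolding g by linarith
  qed
qed

lemma g_II_nonneg:
  assumes "0 < Min A" and "0 \<le> n"
  shows "0 \<le> g_II A n"
  using assms by (simp add: g_I_div_mod(2) pos_imp_zdiv_nonneg_iff)

text \<open>With fewer than \<open>Min A\<close> stones the second player needs no money: the mover is stuck.\<close>

lemma Min_le_if_g_II_pos:
  assumes "0 < Min A" and "0 < g_II A (int n)"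
  shows "Min A \<le> n"
proof (rule ccontr)
  assume "\<not> Min A \<le> n"
  then show False
    using assms by (simp add: g_I_div_mod(2))
qed

text \<open>
  By monotonicity the opponent, who moves next, never faces a higher threshold than before. Since
  \<open>g_I A k + g_II A k = k + 1\<close> drops by exactly \<open>a\<close>, the threshold of the player who has just paid
  \<open>a\<close> then falls by at most \<open>a\<close>, so a poor mover cannot become rich by moving.
\<close>

lemma g_I_after_move_le:
  assumes "0 < Min A" and "int (Min A) \<le> a"
  shows "g_I A (n - a) \<le> g_II A n"
  using monoD[OF mono_g_I[OF assms(1)], of "n - a" "n - int (Min A)"] assms
  by (simp add: g_II_eq_g_I_shift)

lemma g_II_after_move_ge:
  assumes "0 < Min A" and "int (Min A) \<le> a"
  shows "g_I A n - a \<le> g_II A (n - a)"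
  using g_I_after_move_le[OF assms, of n] g_I_plus_g_II[OF assms(1), of n]
    g_I_plus_g_II[OF assms(1), of "n - a"]
  by linarith

lemma g_II_after_Min_move:
  assumes "0 < Min A"
  shows "g_II A (n - int (Min A)) = g_I A n - int (Min A)"
  using g_II_eq_g_I_shift[OF assms, of n] g_I_plus_g_II[OF assms, of n]
    g_I_plus_g_II[OF assms, of "n - int (Min A)"]
  by linarith

lemma player_neq_PlayerI: "p \<noteq> PlayerI \<longleftrightarrow> p = PlayerII"
  by (cases p) simp_all

theorem theorem3p7:
  fixes A :: "nat set" and n d e :: nat
  assumes "finite A" and "A \<noteq> {}" and "\<forall>a\<in>A. 0 < a"
  shows "(int d \<ge> g_I A (int n) \<and> int e < g_II A (int n) \<longrightarrow> W_cash A n d e = PlayerI) \<and>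
    (int d < g_I A (int n) \<and> int e \<ge> g_II A (int n) \<longrightarrow> W_cash A n d e = PlayerII) \<and>
    (int d < g_I A (int n) \<and> int e < g_II A (int n) \<longrightarrow>
      (W_cash A n d e = PlayerI \<longleftrightarrow> d div Min A > e div Min A))"
proof (induction n arbitrary: d e rule: less_induct)
  case (less n)
  let ?m = "Min A"
  have mA: "?m \<in> A" using assms by simp
  have m: "0 < ?m" using assms mA by blast
  have ge_m: "?m \<le> a" if "a \<in> A" for a using assms that by simp
  have rec: "W_cash A n d e = PlayerI \<longleftrightarrow>
      (\<exists>a\<in>A. a \<le> n \<and> a \<le> d \<and> W_cash A (n - a) e (d - a) = PlayerII)"
    by (rule W_cash_rec) (use assms in blast)
  have II_if_poor: "int (d - a) < g_II A (int (n - a))"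
    if "a \<in> A" "a \<le> n" "a \<le> d" "int d < g_I A (int n)" for a
    using g_II_after_move_ge[OF m, of "int a" "int n"] ge_m[OF that(1)] that
    by (simp add: of_nat_diff)
  have m_le_n: "?m \<le> n" if "int e < g_II A (int n)"
    using Min_le_if_g_II_pos[OF m] that by simp
  have after_m: "g_I A (int (n - ?m)) = g_II A (int n)"
      "g_II A (int (n - ?m)) = g_I A (int n) - int ?m" if "int e < g_II A (int n)"
    using m_le_n[OF that] g_II_eq_g_I_shift[OF m, of "int n"] g_II_after_Min_move[OF m, of "int n"]
    by (simp_all add: of_nat_diff)
  show ?case
  proof (intro conjI impI)
    assume h: "int d \<ge> g_I A (int n) \<and> int e < g_II A (int n)"
    have "?m \<le> d"
      using h after_m(2) g_II_nonneg[OF m, of "int (n - ?m)"] by simp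
    moreover have "W_cash A (n - ?m) e (d - ?m) = PlayerII"
      using less.IH[of "n - ?m" e "d - ?m"] m m_le_n h after_m calculation
      by (simp add: of_nat_diff)
    ultimately show "W_cash A n d e = PlayerI"
      using rec mA m_le_n h by blast
  next
    assume h: "int d < g_I A (int n) \<and> int e \<ge> g_II A (int n)"
    have "W_cash A (n - a) e (d - a) = PlayerI" if a: "a \<in> A" "a \<le> n" "a \<le> d" for a
    proof -
      have "g_I A (int (n - a)) \<le> int e"
        using g_I_after_move_le[OF m, of "int a" "int n"] ge_m[OF a(1)] a h
        by (simp add: of_nat_diff)
      then show ?thesis
        using less.IH[of "n - a" e "d - a"] II_if_poor[OF a] ge_m[OF a(1)] m a h by simp
    qed
    then have "W_cash A n d e \<noteq> PlayerI"
      using rec by auto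
    then show "W_cash A n d e = PlayerII"
      by (simp add: player_neq_PlayerI)
  next
    assume h: "int d < g_I A (int n) \<and> int e < g_II A (int n)"
    show "W_cash A n d e = PlayerI \<longleftrightarrow> d div ?m > e div ?m"
    proof
      assume gt: "d div ?m > e div ?m"
      then have md: "?m \<le> d"
        by (metis div_less not_le not_less_zero)
      then have quot: "d div ?m = Suc ((d - ?m) div ?m)"
        using m by (simp add: le_div_geq)
      have "W_cash A (n - ?m) e (d - ?m) \<noteq> PlayerI"
        using less.IH[of "n - ?m" e "d - ?m"] m m_le_n h after_m md quot gt
        by (simp add: of_nat_diff)
      then show "W_cash A n d e = PlayerI"
        using rec mA m_le_n h md by (auto simp: player_neq_PlayerI)
    next
      assume "W_cash A n d e = PlayerI"
      then obtain a where a: "a \<in> A" "a \<le> n" "a \<le> d"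
        and win: "W_cash A (n - a) e (d - a) = PlayerII"
        using rec by blast
      note poor = II_if_poor[OF a]
      \<comment> \<open>A rich opponent would win against the now poor second player, so he is poor as well.\<close>
      have "\<not> e div ?m > (d - a) div ?m"
        using less.IH[of "n - a" e "d - a"] poor ge_m[OF a(1)] m a h win by fastforce
      moreover have "d div ?m > (d - a) div ?m"
      proof -
        have "(d - a) div ?m \<le> (d - ?m) div ?m"
          using ge_m[OF a(1)] by (intro div_le_mono) simp
        then show ?thesis
          using ge_m[OF a(1)] a m by (simp add: le_div_geq)
      qed
      ultimately show "d div ?m > e div ?m" by simp
    qed
  qed
qed

end
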